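(* Let $\mathcal{H}$ be a finite-dimensional Hilbert space, let $\mathcal{U}$ be a unitary on $\mathcal{H}$, and let $\widetilde{\mathcal{U}}$ be the unitary on $\mathcal{H}$ induced by an optimistic quantum circuit for $\mathcal{U}$ with error parameter $\epsilon$, i.e. $\|\widetilde{\mathcal{U}}-\mathcal{U}\|_F^2/\dim\mathcal{H}\le\epsilon$. Suppose the uniform distribution over a finite set of $k$ unitaries $\{V_i\}_{i}$ on $\mathcal{H}$, indexed by $i$, is a unitary 1-design. Let $\{|i\rangle\}$ be an orthonormal basis of $\mathbb{C}^k$ and set $$V'=\sum_i|i\rangle\langle i|\otimes V_i,\qquad \hat V'=\sum_i|i\rangle\langle i|\otimes \mathcal{U}V_i\mathcal{U}^\dagger,\qquad \mathcal{U}'=\hat V'^\dagger(\mathbb{I}\otimes\widetilde{\mathcal{U}})V'.$$ Then for every state (unit vector) $|\psi\rangle\in\mathcal{H}$, $$\left\|(\mathcal{U}'-\mathbb{I}\otimes\mathcal{U})\left(\frac{1}{\sqrt k}\sum_i|i\rangle\otimes|\psi\rangle\right)\right\|^2\le\epsilon .$$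
   Context: $\|A\|_F^2=\mathrm{Tr}[A^\dagger A]$ is the squared Frobenius norm. A quantum circuit inducing a unitary $\widetilde{\mathcal{U}}$ on $\mathcal{H}$ is an optimistic quantum circuit for $\mathcal{U}$ with error parameter $\epsilon$ if $\|\widetilde{\mathcal{U}}-\mathcal{U}\|_F^2/\dim\mathcal{H}\le\epsilon$. The uniform distribution over unitaries $V_1,\dots,V_k$ is a unitary 1-design if for every operator $X$ on $\mathcal{H}$, $\frac1k\sum_iV_iXV_i^\dagger=\mathbb{I}\cdot\mathrm{Tr}[X]/\dim\mathcal{H}$. *)

theory Defs
  imports "HOL-Analysis.Analysis"
begin

text \<open>
  A finite-dimensional Hilbert space with a chosen orthonormal basis is rendered as
  \<^typ>\<open>complex^'n\<close>, of dimension \<open>CARD('n)\<close>, and its operators as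
  \<^typ>\<open>complex^'n^'n\<close>. The tensor product of \<^typ>\<open>complex^'a\<close> and \<^typ>\<open>complex^'b\<close>
  is \<^typ>\<open>complex^('a \<times> 'b)\<close>. The library's \<^const>\<open>norm\<close> on \<^typ>\<open>complex^'n\<close> is the
  Hilbert space norm.
\<close>

definition dagger :: "complex^'n^'m \<Rightarrow> complex^'m^'n" where
  "dagger A = (\<chi> i j. cnj (A $ j $ i))"

definition unitary :: "complex^'n^'n \<Rightarrow> bool" where
  "unitary U \<longleftrightarrow> dagger U ** U = mat 1 \<and> U ** dagger U = mat 1"

text \<open>The trace below is always a nonnegative real, so taking \<^const>\<open>Re\<close> loses nothing.\<close>

definition frobenius_norm_sq :: "complex^'n^'n \<Rightarrow> real" where
  "frobenius_norm_sq A = Re (trace (dagger A ** A))"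

text \<open>A circuit enters only through the unitary \<open>Ut\<close> that it induces.\<close>

definition optimistic_for :: "complex^'n^'n \<Rightarrow> complex^'n^'n \<Rightarrow> real \<Rightarrow> bool" where
  "optimistic_for Ut U \<epsilon> \<longleftrightarrow>
     unitary Ut \<and> frobenius_norm_sq (Ut - U) / real CARD('n) \<le> \<epsilon>"

text \<open>\<^term>\<open>mat c\<close> is \<open>c\<close> times the identity matrix.\<close>

definition unitary_1_design :: "('k::finite \<Rightarrow> complex^'n^'n) \<Rightarrow> bool" where
  "unitary_1_design V \<longleftrightarrow> (\<forall>i. unitary (V i)) \<and>
     (\<forall>X. (1 / real CARD('k)) *\<^sub>R (\<Sum>i\<in>UNIV. V i ** X ** dagger (V i))
           = mat (trace X / of_nat CARD('n)))"

definition cinner :: "complex^'n \<Rightarrow> complex^'n \<Rightarrow> complex" where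
  "cinner x y = (\<Sum>a\<in>UNIV. cnj (x $ a) * y $ a)"

definition orthonormal_basis :: "('k::finite \<Rightarrow> complex^'k) \<Rightarrow> bool" where
  "orthonormal_basis e \<longleftrightarrow>
     (\<forall>i j. cinner (e i) (e j) = (if i = j then 1 else 0)) \<and> vec.span (range e) = UNIV"

definition ket_bra :: "complex^'m \<Rightarrow> complex^'n \<Rightarrow> complex^'n^'m" where
  "ket_bra x y = (\<chi> a b. x $ a * cnj (y $ b))"

definition tensor_vec :: "complex^'a \<Rightarrow> complex^'b \<Rightarrow> complex^('a \<times> 'b)"
    (infixr "\<otimes>\<^sub>v" 75) where
  "x \<otimes>\<^sub>v y = (\<chi> p. x $ fst p * y $ snd p)"

definition tensor_mat ::
  "complex^'a^'c \<Rightarrow> complex^'b^'d \<Rightarrow> complex^('a \<times> 'b)^('c \<times> 'd)"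
    (infixr "\<otimes>\<^sub>m" 75) where
  "A \<otimes>\<^sub>m B = (\<chi> p q. A $ fst p $ fst q * B $ snd p $ snd q)"

end

theory Submission
  imports Defs
begin

text \<open>
  Since \<open>e\<^sub>i\<close> selects the \<open>i\<close>-th block, \<open>(U' - I \<otimes> U) (e\<^sub>i \<otimes> \<psi>) = e\<^sub>i \<otimes> W\<^sub>i (Ut - U) V\<^sub>i \<psi>\<close>
  with \<open>W\<^sub>i = U V\<^sub>i\<^sup>\<dagger> U\<^sup>\<dagger>\<close> unitary, because \<open>W\<^sub>i U V\<^sub>i = U\<close>. By orthogonality the squared norm is
  the average of \<open>\<parallel>(Ut - U) V\<^sub>i \<psi>\<parallel>\<^sup>2\<close>, i.e. the trace of \<open>D X D\<^sup>\<dagger>\<close> where \<open>D = Ut - U\<close> and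
  \<open>X\<close> is the average of the \<open>V\<^sub>i |\<psi>\<rangle>\<langle>\<psi>| V\<^sub>i\<^sup>\<dagger>\<close>. The 1-design property makes \<open>X\<close> maximally mixed,
  so this trace is the normalized squared Frobenius norm of \<open>D\<close>.
\<close>

lemma dagger_mult: "dagger (A ** B) = dagger B ** dagger A"
  by (simp add: dagger_def matrix_matrix_mult_def vec_eq_iff mult.commute)

lemma dagger_dagger [simp]: "dagger (dagger A) = A"
  by (simp add: dagger_def vec_eq_iff)

lemma dagger_sum: "dagger (\<Sum>i\<in>I. A i) = (\<Sum>i\<in>I. dagger (A i))"
  by (simp add: dagger_def vec_eq_iff)

lemma dagger_ket_bra: "dagger (ket_bra x y) = ket_bra y x"
  by (simp add: dagger_def ket_bra_def vec_eq_iff mult.commute)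

lemma dagger_tensor_mat: "dagger (A \<otimes>\<^sub>m B) = dagger A \<otimes>\<^sub>m dagger B"
  by (simp add: dagger_def tensor_mat_def vec_eq_iff)

lemma unitary_dagger: "unitary A \<Longrightarrow> unitary (dagger A)"
  by (simp add: unitary_def)

lemma unitary_mult:
  assumes "unitary A" "unitary B"
  shows "unitary (A ** B)"
proof -
  \<comment> \<open>The bracketing puts each cancelling pair in the middle; associativity then
    yields the unitarity of \<open>A ** B\<close>.\<close>
  have "dagger B ** (dagger A ** A) ** B = mat 1" "A ** (B ** dagger B) ** dagger A = mat 1"
    using assms by (simp_all add: unitary_def)
  then show ?thesis
    by (simp add: unitary_def dagger_mult matrix_mul_assoc)
qed

lemma sum_matrix_vector_mult: "(\<Sum>i\<in>I. A i) *v x = (\<Sum>i\<in>I. A i *v x)"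
  by (induction I rule: infinite_finite_induct) (simp_all add: matrix_vector_mult_add_rdistrib)

lemma matrix_vector_mult_sum: "A *v (\<Sum>i\<in>I. x i) = (\<Sum>i\<in>I. A *v x i)"
  by (induction I rule: infinite_finite_induct) (simp_all add: matrix_vector_right_distrib)

lemma matrix_vector_mult_scaleR_complex:
  "(A :: complex^'n^'m) *v (c *\<^sub>R x) = c *\<^sub>R (A *v x)"
  by (simp add: matrix_vector_mult_def vec_eq_iff scaleR_sum_right)

lemma matrix_mult_scaleR_right:
  "(A :: complex^'n^'m) ** (c *\<^sub>R B) = c *\<^sub>R (A ** B)"
  by (simp add: matrix_matrix_mult_def vec_eq_iff scaleR_sum_right)

lemma matrix_mult_scaleR_left:
  "(c *\<^sub>R (A :: complex^'n^'m)) ** B = c *\<^sub>R (A ** B)"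
  by (simp add: matrix_matrix_mult_def vec_eq_iff scaleR_sum_right)

lemma matrix_mult_sum_right: "A ** (\<Sum>i\<in>I. B i) = (\<Sum>i\<in>I. A ** B i)"
  by (induction I rule: infinite_finite_induct) (simp_all add: matrix_add_ldistrib)

lemma matrix_mult_sum_left: "(\<Sum>i\<in>I. A i) ** B = (\<Sum>i\<in>I. A i ** B)"
  by (induction I rule: infinite_finite_induct)
    (simp_all add: matrix_matrix_mult_def vec_eq_iff distrib_right sum.distrib)

lemma mat_mult_left: "mat c ** (A :: complex^'n^'m) = (\<chi> i j. c * A $ i $ j)"
  by (simp add: matrix_matrix_mult_def mat_def vec_eq_iff if_distrib if_distribR
      cong: if_cong)

lemma trace_sum: "trace (\<Sum>i\<in>I. A i) = (\<Sum>i\<in>I. trace (A i))"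
  unfolding trace_def sum_component by (rule sum.swap)

lemma trace_scaleR: "trace (c *\<^sub>R (A :: complex^'n^'n)) = c *\<^sub>R trace A"
  by (simp add: trace_def scaleR_sum_right)

text \<open>Lets a norm identity be proved with the sesquilinear \<open>cinner\<close> and then
  pulled back to the reals by injectivity of the embedding.\<close>

lemma cinner_self: "cinner x x = complex_of_real ((norm x)\<^sup>2)"
proof -
  have "(norm x)\<^sup>2 = (\<Sum>a\<in>UNIV. (cmod (x $ a))\<^sup>2)"
    by (simp add: norm_vec_def L2_set_def sum_nonneg)
  then show ?thesis
    by (simp add: cinner_def complex_norm_square mult.commute del: of_real_power)
qed

lemma cinner_sum_left: "cinner (\<Sum>i\<in>I. x i) y = (\<Sum>i\<in>I. cinner (x i) y)"
  unfolding cinner_def sum_component cnj_sum sum_distrib_right by (rule sum.swap)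

lemma cinner_sum_right: "cinner x (\<Sum>i\<in>I. y i) = (\<Sum>i\<in>I. cinner x (y i))"
  unfolding cinner_def sum_component sum_distrib_left by (rule sum.swap)

lemma cinner_tensor_vec: "cinner (a \<otimes>\<^sub>v x) (b \<otimes>\<^sub>v y) = cinner a b * cinner x y"
  by (simp add: cinner_def tensor_vec_def sum_product sum.cartesian_product
      case_prod_unfold mult_ac flip: UNIV_Times_UNIV)

lemma cinner_matrix_vector_mult: "cinner (A *v x) y = cinner x (dagger A *v y)"
  unfolding cinner_def matrix_vector_mult_def dagger_def
  by (simp add: sum_distrib_left sum_distrib_right mult_ac) (rule sum.swap)

lemma norm_unitary:
  assumes "unitary A"
  shows "norm (A *v x) = norm x"
proof -
  have "cinner (A *v x) (A *v x) = cinner x x"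
    using assms by (simp add: cinner_matrix_vector_mult matrix_vector_mul_assoc unitary_def)
  then show ?thesis
    unfolding cinner_self of_real_eq_iff by simp
qed

lemma ket_bra_mult_vec: "ket_bra x y *v z = cinner y z *s x"
  by (simp add: ket_bra_def cinner_def matrix_vector_mult_def vec_eq_iff sum_distrib_left
      mult_ac)

text \<open>Conjugation keeps rank-one operators rank one. Right to left it matches the projectors
  onto \<open>V i *v \<psi>\<close> to the 1-design condition; left to right it absorbs
  \<open>D\<close>.\<close>

lemma matrix_mult_ket_bra: "A ** ket_bra x y ** dagger B = ket_bra (A *v x) (B *v y)"
proof -
  have "A ** ket_bra x y = ket_bra (A *v x) y"
    by (simp add: ket_bra_def matrix_matrix_mult_def matrix_vector_mult_def vec_eq_iff
        sum_distrib_left mult_ac)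
  then show ?thesis
    by (simp add: ket_bra_def dagger_def matrix_matrix_mult_def matrix_vector_mult_def vec_eq_iff
        sum_distrib_left mult_ac)
qed

lemma trace_ket_bra: "trace (ket_bra x y) = cinner y x"
  by (simp add: trace_def ket_bra_def cinner_def mult.commute)

lemma tensor_mat_mult_vec: "(A \<otimes>\<^sub>m B) *v (x \<otimes>\<^sub>v y) = (A *v x) \<otimes>\<^sub>v (B *v y)"
  by (simp add: tensor_mat_def tensor_vec_def matrix_vector_mult_def vec_eq_iff sum_product
      sum.cartesian_product case_prod_unfold mult_ac flip: UNIV_Times_UNIV)

lemma tensor_vec_diff_right: "x \<otimes>\<^sub>v (y - z) = x \<otimes>\<^sub>v y - x \<otimes>\<^sub>v z"
  by (simp add: tensor_vec_def vec_eq_iff right_diff_distrib)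

text \<open>Orthonormality kills every summand except the one with \<open>i = j\<close>.\<close>

lemma block_diagonal_mult_vec:
  assumes "orthonormal_basis e"
  shows "(\<Sum>i\<in>UNIV. ket_bra (e i) (e i) \<otimes>\<^sub>m A i) *v (e j \<otimes>\<^sub>v x) = e j \<otimes>\<^sub>v (A j *v x)"
proof -
  have "(ket_bra (e i) (e i) \<otimes>\<^sub>m A i) *v (e j \<otimes>\<^sub>v x)
      = (if i = j then e j \<otimes>\<^sub>v (A j *v x) else 0)" for i
    using assms
    by (simp add: tensor_mat_mult_vec ket_bra_mult_vec orthonormal_basis_def)
      (simp add: tensor_vec_def vec_eq_iff)
  then show ?thesis
    by (simp add: sum_matrix_vector_mult)
qed

text \<open>Pythagoras: \<open>cinner\<close> factors over the tensor product, so orthogonality in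
  the first factor removes all cross terms, whatever the \<open>x i\<close> are.\<close>

lemma norm_sq_sum_orthonormal_tensor:
  assumes "orthonormal_basis e"
  shows "(norm (\<Sum>i\<in>UNIV. e i \<otimes>\<^sub>v x i))\<^sup>2 = (\<Sum>i\<in>UNIV. (norm (x i))\<^sup>2)"
proof -
  have "cinner (\<Sum>i\<in>UNIV. e i \<otimes>\<^sub>v x i) (\<Sum>i\<in>UNIV. e i \<otimes>\<^sub>v x i)
      = (\<Sum>i\<in>UNIV. \<Sum>j\<in>UNIV. if i = j then cinner (x i) (x j) else 0)"
    unfolding cinner_sum_left cinner_sum_right cinner_tensor_vec
    using assms by (intro sum.cong) (auto simp: orthonormal_basis_def)
  also have "\<dots> = (\<Sum>i\<in>UNIV. cinner (x i) (x i))"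
    by simp
  finally show ?thesis
    unfolding cinner_self of_real_sum[symmetric] of_real_eq_iff .
qed

lemma unitary_1_design_average_norm_sq:
  fixes V :: "'k::finite \<Rightarrow> complex^'n^'n" and D :: "complex^'n^'n"
  assumes "unitary_1_design V"
  shows "(\<Sum>i\<in>UNIV. (norm (D *v (V i *v \<psi>)))\<^sup>2) / real CARD('k)
    = (norm \<psi>)\<^sup>2 * frobenius_norm_sq D / real CARD('n)"
proof -
  \<comment> \<open>The scalar that the 1-design property assigns to the choice
    \<open>X = ket_bra \<psi> \<psi>\<close>.\<close>
  define c where "c = trace (ket_bra \<psi> \<psi>) / of_nat CARD('n)"
  have "(1 / real CARD('k)) *\<^sub>R (\<Sum>i\<in>UNIV. ket_bra (V i *v \<psi>) (V i *v \<psi>)) = mat c"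
    using assms by (simp add: unitary_1_design_def c_def flip: matrix_mult_ket_bra)
  then have "trace (D ** ((1 / real CARD('k)) *\<^sub>R (\<Sum>i\<in>UNIV. ket_bra (V i *v \<psi>) (V i *v \<psi>)))
      ** dagger D) = trace (D ** mat c ** dagger D)"
    by simp
  \<comment> \<open>Cyclicity of the trace moves \<open>D\<close> to the far right, next to
    \<open>dagger D\<close>.\<close>
  also have "\<dots> = trace (mat c ** (dagger D ** D))"
    using trace_mul_sym[of D "mat c ** dagger D"] by (simp add: matrix_mul_assoc)
  also have "\<dots> = c * trace (dagger D ** D)"
    by (simp add: mat_mult_left trace_def sum_distrib_left)
  \<comment> \<open>By linearity \<open>D\<close> enters the sum, where each term becomes the trace
    of \<open>ket_bra v v\<close> with \<open>v = D *v (V i *v \<psi>)\<close>, which is the squared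
    norm of \<open>v\<close>.\<close>
  finally have "(1 / real CARD('k)) *\<^sub>R (\<Sum>i\<in>UNIV. complex_of_real ((norm (D *v (V i *v \<psi>)))\<^sup>2))
      = c * trace (dagger D ** D)"
    by (simp only: matrix_mult_scaleR_right matrix_mult_scaleR_left matrix_mult_sum_right
        matrix_mult_sum_left matrix_mult_ket_bra trace_scaleR trace_sum trace_ket_bra cinner_self)
  moreover have "c = complex_of_real ((norm \<psi>)\<^sup>2 / real CARD('n))"
    by (simp add: c_def trace_ket_bra cinner_self)
  \<comment> \<open>Since \<open>c\<close> is real, it can be pulled out of \<open>Re\<close>,
    leaving the Frobenius norm as defined.\<close>
  ultimately have "Re ((1 / real CARD('k)) *\<^sub>R
        (\<Sum>i\<in>UNIV. complex_of_real ((norm (D *v (V i *v \<psi>)))\<^sup>2)))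
      = Re (complex_of_real ((norm \<psi>)\<^sup>2 / real CARD('n)) * trace (dagger D ** D))"
    by simp
  then show ?thesis
    unfolding of_real_sum[symmetric] Re_complex_of_real frobenius_norm_sq_def
    by simp
qed

theorem theorem2:
  fixes U Ut :: "complex^'n^'n"
    and V :: "'k::finite \<Rightarrow> complex^'n^'n"
    and e :: "'k \<Rightarrow> complex^'k"
    and \<epsilon> :: real
    and V' Vhat' U' :: "complex^('k \<times> 'n)^('k \<times> 'n)"
    and \<psi> :: "complex^'n"
  assumes "unitary U"
    and "optimistic_for Ut U \<epsilon>"
    and "unitary_1_design V"
    and "orthonormal_basis e"
    and "V' = (\<Sum>i\<in>UNIV. ket_bra (e i) (e i) \<otimes>\<^sub>m V i)"
    and "Vhat' = (\<Sum>i\<in>UNIV. ket_bra (e i) (e i) \<otimes>\<^sub>m (U ** V i ** dagger U))"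
    and "U' = dagger Vhat' ** (mat 1 \<otimes>\<^sub>m Ut) ** V'"
    and "norm \<psi> = 1"
  shows "(norm ((U' - mat 1 \<otimes>\<^sub>m U) *v
            ((1 / sqrt (real CARD('k))) *\<^sub>R (\<Sum>i\<in>UNIV. e i \<otimes>\<^sub>v \<psi>))))\<^sup>2 \<le> \<epsilon>"
proof -
  define D where "D = Ut - U"
  define W where "W i = U ** dagger (V i) ** dagger U" for i
  have V: "unitary (V i)" for i
    using assms(3) by (simp add: unitary_1_design_def)
  have W: "unitary (W i)" for i
    unfolding W_def by (intro unitary_mult unitary_dagger assms(1) V)
  \<comment> \<open>This gives the ideal operator the same outer factors as the actual one, so that
    their difference contains \<open>D\<close> in the middle.\<close>
  have WUV: "W i ** U ** V i = U" for i
  proof -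
    have "W i ** U ** V i = U ** (dagger (V i) ** ((dagger U ** U) ** V i))"
      by (simp add: W_def matrix_mul_assoc)
    then show ?thesis
      using assms(1) V[of i] by (simp add: unitary_def)
  qed
  have "dagger Vhat' = (\<Sum>i\<in>UNIV. ket_bra (e i) (e i) \<otimes>\<^sub>m W i)"
    by (simp add: assms(6) W_def dagger_sum dagger_tensor_mat dagger_ket_bra dagger_mult
        matrix_mul_assoc)
  \<comment> \<open>All three factors of \<open>U'\<close> preserve the block \<open>e i\<close>, so
    they act in turn on the second factor alone.\<close>
  then have block: "U' *v (e i \<otimes>\<^sub>v \<psi>) = e i \<otimes>\<^sub>v ((W i ** Ut ** V i) *v \<psi>)" for i
    using assms(4) by (simp add: assms(5,7) block_diagonal_mult_vec tensor_mat_mult_vec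
        flip: matrix_vector_mul_assoc)
  have "(U' - mat 1 \<otimes>\<^sub>m U) *v (e i \<otimes>\<^sub>v \<psi>) = e i \<otimes>\<^sub>v (W i *v (D *v (V i *v \<psi>)))" for i
  proof -
    have "(U' - mat 1 \<otimes>\<^sub>m U) *v (e i \<otimes>\<^sub>v \<psi>)
        = e i \<otimes>\<^sub>v ((W i ** Ut ** V i) *v \<psi> - (W i ** U ** V i) *v \<psi>)"
      by (simp add: matrix_vector_mult_diff_rdistrib block tensor_mat_mult_vec
          tensor_vec_diff_right WUV)
    also have "(W i ** Ut ** V i) *v \<psi> - (W i ** U ** V i) *v \<psi> = W i *v (D *v (V i *v \<psi>))"
      by (simp add: D_def matrix_vector_mult_diff_rdistrib matrix_vector_mult_diff_distrib
          flip: matrix_vector_mul_assoc)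
    finally show ?thesis .
  qed
  \<comment> \<open>Squaring turns the amplitude \<open>1 / sqrt k\<close> into the weight
    \<open>1 / k\<close> of a uniform average.\<close>
  then have "(norm ((U' - mat 1 \<otimes>\<^sub>m U) *v
      ((1 / sqrt (real CARD('k))) *\<^sub>R (\<Sum>i\<in>UNIV. e i \<otimes>\<^sub>v \<psi>))))\<^sup>2
      = (norm (\<Sum>i\<in>UNIV. e i \<otimes>\<^sub>v (W i *v (D *v (V i *v \<psi>)))))\<^sup>2 / real CARD('k)"
    by (simp add: matrix_vector_mult_scaleR_complex matrix_vector_mult_sum power_divide)
  also have "\<dots> = (\<Sum>i\<in>UNIV. (norm (D *v (V i *v \<psi>)))\<^sup>2) / real CARD('k)"
    by (simp add: norm_sq_sum_orthonormal_tensor[OF assms(4)] norm_unitary[OF W])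
  also have "\<dots> = frobenius_norm_sq D / real CARD('n)"
    using unitary_1_design_average_norm_sq[OF assms(3)] assms(8) by simp
  also have "\<dots> \<le> \<epsilon>"
    using assms(2) by (simp add: optimistic_for_def D_def)
  finally show ?thesis .
qed

end
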